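(* Let $U$ be an entrywise nonnegative real $n\times n$ matrix such that $\tau(f(U))=\infty$ for every increasing function $f:\mathbb{R}_+\to\mathbb{R}_+$. Then $U$ is a generalized ultrametric matrix (GUM).
   Context: All matrices are real and square; $'$ denotes transpose; $\mathbb{I}$ is the identity matrix; $\mathbb{R}_+=[0,\infty)$. "Increasing" means non-decreasing (not necessarily strictly increasing). $f(U)$ is the matrix with entries $f(U_{ij})$. A nonnegative matrix $V$ is a bi-potential if it is nonsingular and $(V^{-1})_{ij}\le 0$ for $i\neq j$, $(V^{-1})_{ii}>0$, $\sum_j (V^{-1})_{ij}\ge 0$ for every $i$, and $\sum_i (V^{-1})_{ij}\ge 0$ for every $j$. For a nonnegative matrix $V$, $\tau(V)=\inf\{t\ge 0:\ \mathbb{I}+tV \text{ is not a bi-potential}\}$, with $\inf\emptyset=\infty$. A nonnegative matrix $U$ of size $n$ is a GUM if $U_{ii}\ge\max\{U_{ij},U_{ji}\}$ for all $i,j$, and either $n\le 2$, or $n>2$ and every set of three distinct indices has a preferred element, where $i$ is a preferred element of $\{i,j,k\}$ if: $U_{ij}=U_{ik}$; $U_{ji}=U_{ki}$; $\min\{U_{jk},U_{kj}\}\ge\min\{U_{ji},U_{ij}\}$; and $\max\{U_{jk},U_{kj}\}\ge\max\{U_{ji},U_{ij}\}$. *)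

theory Defs
  imports "HOL-Analysis.Analysis"
begin

definition nonneg_matrix :: "real^'n^'n \<Rightarrow> bool" where
  "nonneg_matrix V \<longleftrightarrow> (\<forall>i j. 0 \<le> V $ i $ j)"

definition bi_potential :: "real^'n^'n \<Rightarrow> bool" where
  "bi_potential V \<longleftrightarrow>
     nonneg_matrix V \<and> invertible V \<and>
     (\<forall>i j. i \<noteq> j \<longrightarrow> matrix_inv V $ i $ j \<le> 0) \<and>
     (\<forall>i. 0 < matrix_inv V $ i $ i) \<and>
     (\<forall>i. 0 \<le> (\<Sum>j\<in>UNIV. matrix_inv V $ i $ j)) \<and>
     (\<forall>j. 0 \<le> (\<Sum>i\<in>UNIV. matrix_inv V $ i $ j))"

(* Only meaningful for nonnegative V. The infimum is taken in the extended reals,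
   where the infimum of the empty set is \<infinity>. *)
definition tau :: "real^'n^'n \<Rightarrow> ereal" where
  "tau V = Inf (ereal ` {t. 0 \<le> t \<and> \<not> bi_potential (mat 1 + t *\<^sub>R V)})"

definition preferred_element :: "real^'n^'n \<Rightarrow> 'n \<Rightarrow> 'n \<Rightarrow> 'n \<Rightarrow> bool" where
  "preferred_element U i j k \<longleftrightarrow>
     U $ i $ j = U $ i $ k \<and>
     U $ j $ i = U $ k $ i \<and>
     min (U $ j $ k) (U $ k $ j) \<ge> min (U $ j $ i) (U $ i $ j) \<and>
     max (U $ j $ k) (U $ k $ j) \<ge> max (U $ j $ i) (U $ i $ j)"

(* preferred_element U i j k is symmetric in j and k (given its first two clauses), so
   the three disjuncts below cover all ways of choosing a preferred element of {i, j, k}. *)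
definition GUM :: "real^'n^'n \<Rightarrow> bool" where
  "GUM U \<longleftrightarrow>
     nonneg_matrix U \<and>
     (\<forall>i j. U $ i $ i \<ge> max (U $ i $ j) (U $ j $ i)) \<and>
     (CARD('n) \<le> 2 \<or>
      CARD('n) > 2 \<and>
      (\<forall>i j k. i \<noteq> j \<and> i \<noteq> k \<and> j \<noteq> k \<longrightarrow>
         preferred_element U i j k \<or> preferred_element U j i k \<or> preferred_element U k i j))"

end

theory Submission
  imports Defs
begin

text \<open>
  A bi-potential \<open>V\<close> satisfies the complete maximum principle: if \<open>V g \<le> c\<close> wherever \<open>g > 0\<close>, with
  \<open>c \<ge> 0\<close>, then \<open>V g \<le> c\<close> everywhere. So does its transpose. Applying this to \<open>I + t f(U)\<close>, dividing
  by \<open>t\<close> and letting \<open>t\<close> tend to infinity, the matrices \<open>f(U)\<close> and their transposes inherit it.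
  Testing it with \<open>g\<close> supported on two indices and with \<open>f\<close> a step function taking the values
  0, 1/2, 1 yields inequalities between the entries of \<open>U\<close> indexed by a triple. They say in
  particular that both \<open>min {U\<^sub>i\<^sub>j, U\<^sub>j\<^sub>i}\<close> and \<open>max {U\<^sub>i\<^sub>j, U\<^sub>j\<^sub>i}\<close> are ultrametric, and they force a
  preferred element.
\<close>

section \<open>The complete maximum principle for bi-potentials and their limits\<close>

definition complete_max_principle :: "real^'n^'n \<Rightarrow> bool" where
  "complete_max_principle W \<longleftrightarrow>
     (\<forall>g c. 0 \<le> c \<longrightarrow> (\<forall>i. 0 < g $ i \<longrightarrow> (W *v g) $ i \<le> c) \<longrightarrow> (\<forall>i. (W *v g) $ i \<le> c))"

text \<open>At a maximum \<open>p\<close> of \<open>u = V *v h\<close> with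
  \<open>u $ p > 0\<close>, the signs and row sums of \<open>M\<close> give
  \<open>h $ p = (M *v u) $ p \<ge> 0\<close>. Hence a positive maximum cannot sit where
  \<open>h\<close> is negative.\<close>

lemma complete_max_principle_left_inverse:
  fixes V M :: "real^'n^'n"
  assumes nonneg: "nonneg_matrix V"
    and inv: "M ** V = mat 1"
    and off: "\<And>i j. i \<noteq> j \<Longrightarrow> M $ i $ j \<le> 0"
    and row: "\<And>i. 0 \<le> (\<Sum>j\<in>UNIV. M $ i $ j)"
  shows "complete_max_principle V"
  unfolding complete_max_principle_def
proof (intro allI impI, rule ccontr)
  fix g :: "real^'n" and c i
  assume c: "0 \<le> c" and bound: "\<forall>i. 0 < g $ i \<longrightarrow> (V *v g) $ i \<le> c" and "\<not> (V *v g) $ i \<le> c"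
  then have gt: "c < (V *v g) $ i" by simp
  define e :: "real^'n" where "e = (\<chi> j. if g $ j \<le> 0 then 1 else 0)"
  have Ve: "0 \<le> (V *v e) $ q" for q
    using nonneg unfolding nonneg_matrix_def matrix_vector_mult_def e_def
    by (auto intro!: sum_nonneg)
  \<comment> \<open>Small enough that subtracting \<open>d *\<^sub>R e\<close> from \<open>g\<close>
    costs at most half of the excess over \<open>c\<close> at \<open>i\<close>; the
    \<open>+ 1\<close> guards against \<open>(V *v e) $ i = 0\<close>.\<close>
  define d where "d = ((V *v g) $ i - c) / (2 * ((V *v e) $ i + 1))"
  have d: "0 < d" using gt Ve[of i] by (simp add: d_def)
  have "d * (V *v e) $ i \<le> d * ((V *v e) $ i + 1)" using d by simp
  also have "\<dots> = ((V *v g) $ i - c) / 2" using Ve[of i] by (simp add: d_def field_simps)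
  also have "\<dots> < (V *v g) $ i - c" using gt by simp
  finally have small: "d * (V *v e) $ i < (V *v g) $ i - c" .
  \<comment> \<open>With \<open>g\<close> strictly negative off its positive set, the weak inequality at a maximum is contradictory.\<close>
  define h where "h = g - d *\<^sub>R e"
  define u where "u = V *v h"
  have u: "u $ q = (V *v g) $ q - d * (V *v e) $ q" for q
    by (simp add: u_def h_def matrix_vector_mult_diff_distrib matrix_vector_mult_scaleR)
  obtain p where p: "\<And>q. u $ q \<le> u $ p"
  proof -
    have "Max (range (\<lambda>q. u $ q)) \<in> range (\<lambda>q. u $ q)" by (rule Max_in) auto
    then obtain p where "Max (range (\<lambda>q. u $ q)) = u $ p" by blast
    moreover have "u $ q \<le> Max (range (\<lambda>q. u $ q))" for q by (rule Max_ge) auto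
    ultimately show thesis using that[of p] by simp
  qed
  have up: "c < u $ p" using p[of i] small u[of i] by simp
  \<comment> \<open>Since \<open>V *v e\<close> is nonnegative, \<open>V *v g\<close> also exceeds
    \<open>c\<close> at \<open>p\<close>, so \<open>g\<close> cannot be positive there.\<close>
  have "0 \<le> d * (V *v e) $ p" using d Ve[of p] by simp
  then have "\<not> 0 < g $ p" using spec[OF bound, of p] up u[of p] by auto
  then have hp: "h $ p < 0" using d by (simp add: h_def e_def)
  have "h = M *v u"
    by (simp add: u_def matrix_vector_mul_assoc inv)
  then have "h $ p = (\<Sum>j\<in>UNIV. M $ p $ j * u $ j)"
    by (simp add: matrix_vector_mult_def)
  also have "\<dots> \<ge> (\<Sum>j\<in>UNIV. M $ p $ j * u $ p)"
  proof (rule sum_mono)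
    fix j show "M $ p $ j * u $ p \<le> M $ p $ j * u $ j"
      using off[of p j] p[of j] by (cases "p = j") (auto intro: mult_left_mono_neg)
  qed
  also have "(\<Sum>j\<in>UNIV. M $ p $ j * u $ p) = (\<Sum>j\<in>UNIV. M $ p $ j) * u $ p"
    by (simp add: sum_distrib_right)
  also have "\<dots> \<ge> 0" using row up c by simp
  finally show False using hp by simp
qed

text \<open>Row sums of the inverse serve \<open>V\<close>; transposition turns column sums into row
  sums and a right inverse into a left one.\<close>

lemma bi_potential_complete_max_principle:
  fixes V :: "real^'n^'n"
  assumes "bi_potential V"
  shows "complete_max_principle V" "complete_max_principle (transpose V)"
proof -
  have inv: "invertible V" and nonneg: "nonneg_matrix V" using assms by (auto simp: bi_potential_def)
  have inverse: "matrix_inv V ** V = mat 1" "V ** matrix_inv V = mat 1"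
    using someI_ex[OF inv[unfolded invertible_def]] by (auto simp: matrix_inv_def)
  show "complete_max_principle V"
    by (rule complete_max_principle_left_inverse[OF nonneg inverse(1)])
      (use assms in \<open>auto simp: bi_potential_def\<close>)
  have "transpose (matrix_inv V) ** transpose V = mat 1"
    by (metis inverse(2) matrix_transpose_mul transpose_mat)
  then show "complete_max_principle (transpose V)"
    by (rule complete_max_principle_left_inverse[rotated])
      (use assms in \<open>auto simp: bi_potential_def nonneg_matrix_def transpose_def\<close>)
qed

text \<open>A violation for \<open>W\<close> grows linearly in \<open>t\<close>, whereas the
  identity contributes only the bounded term \<open>g\<close>.\<close>

lemma complete_max_principle_limit:
  fixes W :: "real^'n^'n"
  assumes "\<And>t. 0 \<le> t \<Longrightarrow> complete_max_principle (mat 1 + t *\<^sub>R W)"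
  shows "complete_max_principle W"
  unfolding complete_max_principle_def
proof (intro allI impI, rule ccontr)
  fix g :: "real^'n" and c i
  assume c: "0 \<le> c" and bound: "\<forall>i. 0 < g $ i \<longrightarrow> (W *v g) $ i \<le> c" and "\<not> (W *v g) $ i \<le> c"
  then have gt: "0 < (W *v g) $ i - c" by simp
  \<comment> \<open>The violation times \<open>t\<close> is \<open>2 * norm g + 1\<close>, while the
    identity accounts for at most \<open>norm g\<close> on each side.\<close>
  define t where "t = (2 * norm g + 1) / ((W *v g) $ i - c)"
  have t: "0 \<le> t" using gt by (simp add: t_def)
  have eq: "((mat 1 + t *\<^sub>R W) *v g) $ q = g $ q + t * (W *v g) $ q" for q
    by (simp add: matrix_vector_mult_add_rdistrib scaleR_matrix_vector_assoc[symmetric])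
  have g: "\<bar>g $ q\<bar> \<le> norm g" for q by (rule component_le_norm_cart)
  have "((mat 1 + t *\<^sub>R W) *v g) $ q \<le> norm g + t * c" if "0 < g $ q" for q
    unfolding eq using g[of q] bound that t by (intro add_mono mult_left_mono) auto
  moreover have "0 \<le> norm g + t * c" using t c by simp
  ultimately have "g $ i + t * (W *v g) $ i \<le> norm g + t * c"
    using assms[OF t] unfolding complete_max_principle_def eq[symmetric] by blast
  then have "t * ((W *v g) $ i - c) \<le> 2 * norm g" using g[of i] by (simp add: algebra_simps)
  then show False using gt by (simp add: t_def)
qed

lemma tau_infinity_bi_potential:
  assumes "tau W = \<infinity>" "0 \<le> t"
  shows "bi_potential (mat 1 + t *\<^sub>R W)"
proof (rule ccontr)
  assume "\<not> ?thesis"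
  then have "tau W \<le> ereal t" using assms(2) unfolding tau_def by (intro Inf_lower) auto
  then show False using assms(1) by simp
qed

lemma tau_infinity_complete_max_principle:
  fixes W :: "real^'n^'n"
  assumes "tau W = \<infinity>"
  shows "complete_max_principle W" "complete_max_principle (transpose W)"
proof -
  note bp = bi_potential_complete_max_principle[OF tau_infinity_bi_potential[OF assms]]
  show "complete_max_principle W"
    by (rule complete_max_principle_limit) (rule bp)
  have "transpose (mat 1 + t *\<^sub>R W) = mat 1 + t *\<^sub>R transpose W" for t
    by (simp add: vec_eq_iff transpose_def mat_def eq_commute)
  then show "complete_max_principle (transpose W)"
    using bp(2) complete_max_principle_limit[of "transpose W"] by simp
qed

section \<open>Entry inequalities from two-index test vectors and step functions\<close>

lemma complete_max_principle_two:
  fixes W :: "real^'n^'n"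
  assumes "complete_max_principle W" "j \<noteq> k" "0 \<le> c"
    and "0 < a \<Longrightarrow> a * W $ j $ j + b * W $ j $ k \<le> c"
    and "0 < b \<Longrightarrow> a * W $ k $ j + b * W $ k $ k \<le> c"
  shows "a * W $ i $ j + b * W $ i $ k \<le> c"
proof -
  define g :: "real^'n" where "g = a *\<^sub>R axis j 1 + b *\<^sub>R axis k 1"
  have Wg: "(W *v g) $ q = a * W $ q $ j + b * W $ q $ k" for q
    by (simp add: g_def matrix_vector_right_distrib matrix_vector_mult_scaleR
        matrix_vector_mult_basis column_def)
  have "(W *v g) $ q \<le> c" if "0 < g $ q" for q
  proof -
    have "q = j \<and> 0 < a \<or> q = k \<and> 0 < b"
      using that assms(2) by (auto simp: g_def axis_def split: if_splits)
    then show ?thesis using assms(4,5) unfolding Wg by blast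
  qed
  then show ?thesis using assms(1,3) unfolding complete_max_principle_def Wg[symmetric] by blast
qed

text \<open>For \<open>a = b\<close> this is the indicator of \<open>[a, \<infinity>)\<close>; the
  middle value matters only in \<open>two_step_shortcut\<close>.\<close>

definition two_step :: "real \<Rightarrow> real \<Rightarrow> real \<Rightarrow> real" where
  "two_step a b x = (if x < a then 0 else if x < b then 1/2 else 1)"

lemma two_step_range: "two_step a b ` {0..} \<subseteq> {0..}"
  by (auto simp: two_step_def)

lemma mono_on_two_step: "a \<le> b \<Longrightarrow> mono_on A (two_step a b)"
  by (auto simp: two_step_def mono_on_def)

context
  fixes U :: "real^'n^'n"
  assumes diag: "\<And>i j. U $ i $ j \<le> U $ i $ i" "\<And>i j. U $ j $ i \<le> U $ i $ i"
    and cmp: "\<And>a b. a \<le> b \<Longrightarrow> complete_max_principle (map_matrix (two_step a b) U)"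
begin

text \<open>If it failed, thresholding at the left side would make the test vector
  \<open>e_k - e_j\<close> give 0 in row \<open>k\<close>, its only positive index, but 1 in row
  \<open>i\<close>.\<close>

lemma two_step_min_le:
  assumes "k \<noteq> j"
  shows "min (U $ i $ k) (U $ k $ j) \<le> U $ i $ j"
proof (rule ccontr)
  define a where "a = min (U $ i $ k) (U $ k $ j)"
  define W where "W = map_matrix (two_step a a) U"
  assume "\<not> ?thesis"
  then have W: "W $ i $ k = 1" "W $ k $ j = 1" "W $ i $ j = 0" "W $ k $ k = 1"
    using diag(1)[of k j] by (auto simp: W_def two_step_def map_matrix_def a_def)
  have "1 * W $ i $ k + (-1) * W $ i $ j \<le> 0"
    by (rule complete_max_principle_two) (use assms W cmp in \<open>auto simp: W_def\<close>)
  then show False using W by simp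
qed

text \<open>If it failed, thresholding at the left side would make \<open>e_j + e_k\<close> give 1
  in rows \<open>j\<close> and \<open>k\<close> but 2 in row \<open>i\<close>.\<close>

lemma two_step_min_le_max:
  assumes "j \<noteq> k"
  shows "min (U $ i $ j) (U $ i $ k) \<le> max (U $ j $ k) (U $ k $ j)"
proof (rule ccontr)
  define a where "a = min (U $ i $ j) (U $ i $ k)"
  define W where "W = map_matrix (two_step a a) U"
  assume "\<not> ?thesis"
  then have W: "W $ i $ k = 1" "W $ i $ j = 1" "W $ j $ k = 0" "W $ k $ j = 0"
    "W $ k $ k = 1" "W $ j $ j = 1"
    using diag(2)[of i k] diag(2)[of i j] by (auto simp: W_def two_step_def map_matrix_def a_def)
  have "1 * W $ i $ j + 1 * W $ i $ k \<le> 1"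
    by (rule complete_max_principle_two) (use assms W cmp in \<open>auto simp: W_def\<close>)
  then show False using W by simp
qed

lemma two_step_shortcut:
  assumes "i \<noteq> j" "U $ k $ i < U $ k $ j" "U $ i $ j < U $ k $ j"
  shows "min (U $ k $ i) (U $ i $ j) \<le> U $ j $ i"
proof (rule ccontr)
  define a where "a = min (U $ k $ i) (U $ i $ j)"
  define W where "W = map_matrix (two_step a (U $ k $ j)) U"
  assume "\<not> ?thesis"
  then have W: "W $ k $ i = 1/2" "W $ i $ j = 1/2" "W $ j $ i = 0" "W $ k $ j = 1" "W $ j $ j = 1"
    "W $ i $ i \<ge> 1/2"
    using assms diag(2)[of k j] diag(1)[of i j]
    by (auto simp: W_def two_step_def map_matrix_def a_def)
  have "complete_max_principle W"
    unfolding W_def by (rule cmp) (use assms in \<open>auto simp: a_def\<close>)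
  \<comment> \<open>The weights make rows \<open>i\<close> and \<open>j\<close> both equal to
    \<open>W $ i $ i\<close>, whether that entry is 1/2 or 1; row \<open>k\<close> exceeds it by
    1/4.\<close>
  then have "(1/2) * W $ k $ i + W $ i $ i * W $ k $ j \<le> W $ i $ i"
    by (rule complete_max_principle_two) (use assms(1) W(6) in \<open>simp_all add: W(1-5)\<close>)
  then show False using W by simp
qed

end

section \<open>From entry inequalities to a preferred element\<close>

text \<open>With \<open>ij\<close> standing for \<open>U $ i $ j\<close> and so on, only the
  relative order of six reals matters, so a finite case analysis decides the claim.\<close>

lemma preferred_element_exists_reals:
  fixes ij ji ik ki jk kj :: real
  assumes "min ik kj \<le> ij" "min ij jk \<le> ik" "min jk ki \<le> ji"
      "min ji ik \<le> jk" "min kj ji \<le> ki" "min ki ij \<le> kj"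
    and "min ij ik \<le> max jk kj" "min ji jk \<le> max ik ki" "min ki kj \<le> max ij ji"
    and "min ji ki \<le> max jk kj" "min ij kj \<le> max ik ki" "min ik jk \<le> max ij ji"
    and "ki < kj \<Longrightarrow> ij < kj \<Longrightarrow> min ki ij \<le> ji \<and> min ki ij \<le> ik"
    and "kj < ki \<Longrightarrow> ji < ki \<Longrightarrow> min kj ji \<le> ij \<and> min kj ji \<le> jk"
    and "ji < jk \<Longrightarrow> ik < jk \<Longrightarrow> min ji ik \<le> ki \<and> min ji ik \<le> ij"
    and "jk < ji \<Longrightarrow> ki < ji \<Longrightarrow> min jk ki \<le> ik \<and> min jk ki \<le> kj"
    and "ij < ik \<Longrightarrow> jk < ik \<Longrightarrow> min ij jk \<le> kj \<and> min ij jk \<le> ji"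
    and "ik < ij \<Longrightarrow> kj < ij \<Longrightarrow> min ik kj \<le> jk \<and> min ik kj \<le> ki"
  shows "(ij = ik \<and> ji = ki \<and> min ji ij \<le> min jk kj \<and> max ji ij \<le> max jk kj) \<or>
   (ji = jk \<and> ij = kj \<and> min ij ji \<le> min ik ki \<and> max ij ji \<le> max ik ki) \<or>
   (ki = kj \<and> ik = jk \<and> min ik ki \<le> min ij ji \<and> max ik ki \<le> max ij ji)"
  using assms by (smt (verit))

lemma preferred_element_exists:
  fixes U :: "real^'n^'n"
  assumes tri: "\<And>i j k. k \<noteq> j \<Longrightarrow> min (U $ i $ k) (U $ k $ j) \<le> U $ i $ j"
    and row: "\<And>i j k. j \<noteq> k \<Longrightarrow> min (U $ i $ j) (U $ i $ k) \<le> max (U $ j $ k) (U $ k $ j)"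
    and col: "\<And>i j k. j \<noteq> k \<Longrightarrow> min (U $ j $ i) (U $ k $ i) \<le> max (U $ j $ k) (U $ k $ j)"
    and short: "\<And>i j k. i \<noteq> j \<Longrightarrow> U $ k $ i < U $ k $ j \<Longrightarrow> U $ i $ j < U $ k $ j \<Longrightarrow>
      min (U $ k $ i) (U $ i $ j) \<le> U $ j $ i"
    and short': "\<And>i j k. i \<noteq> k \<Longrightarrow> U $ k $ i < U $ k $ j \<Longrightarrow> U $ i $ j < U $ k $ j \<Longrightarrow>
      min (U $ k $ i) (U $ i $ j) \<le> U $ i $ k"
    and ne: "i \<noteq> j" "i \<noteq> k" "j \<noteq> k"
  shows "preferred_element U i j k \<or> preferred_element U j i k \<or> preferred_element U k i j"
  unfolding preferred_element_def
proof (rule preferred_element_exists_reals)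
  show "min (U $ i $ j) (U $ i $ k) \<le> max (U $ j $ k) (U $ k $ j)"
    "min (U $ j $ i) (U $ j $ k) \<le> max (U $ i $ k) (U $ k $ i)"
    "min (U $ k $ i) (U $ k $ j) \<le> max (U $ i $ j) (U $ j $ i)"
    by (intro row ne)+
  show "min (U $ j $ i) (U $ k $ i) \<le> max (U $ j $ k) (U $ k $ j)"
    "min (U $ i $ j) (U $ k $ j) \<le> max (U $ i $ k) (U $ k $ i)"
    "min (U $ i $ k) (U $ j $ k) \<le> max (U $ i $ j) (U $ j $ i)"
    by (intro col ne)+
qed ((intro conjI tri short short' ne ne[symmetric]; assumption)+)

theorem theorem2p4:
  fixes U :: "real^'n^'n"
  assumes "nonneg_matrix U"
    and "\<And>f :: real \<Rightarrow> real. f ` {0..} \<subseteq> {0..} \<Longrightarrow> mono_on {0..} f \<Longrightarrow> tau (map_matrix f U) = \<infinity>"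
  shows "GUM U"
proof -
  have cmp: "complete_max_principle (map_matrix f U)"
    "complete_max_principle (map_matrix f (transpose U))"
    if "f ` {0..} \<subseteq> {0..}" "mono_on {0..} f" for f :: "real \<Rightarrow> real"
  proof -
    have "map_matrix f (transpose U) = transpose (map_matrix f U)"
      by (simp add: vec_eq_iff transpose_def map_matrix_def)
    then show "complete_max_principle (map_matrix f U)"
      "complete_max_principle (map_matrix f (transpose U))"
      using tau_infinity_complete_max_principle[OF assms(2)[OF that]] by auto
  qed
  \<comment> \<open>The test vector is \<open>e_j\<close> with bound \<open>A $ j $ j\<close>;
    \<open>A\<close> is left general to cover both \<open>U\<close> and its transpose.\<close>
  have diag_le: "A $ i $ j \<le> A $ j $ j" if "complete_max_principle (map_matrix id A)" "nonneg_matrix A"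
    for A :: "real^'n^'n" and i j
  proof (cases "i = j")
    case False
    have "map_matrix id A = A" by (simp add: vec_eq_iff map_matrix_def)
    then have "complete_max_principle A" using that(1) by simp
    then have "1 * A $ i $ j + 0 * A $ i $ i \<le> A $ j $ j"
      by (rule complete_max_principle_two) (use that(2) False in \<open>auto simp: nonneg_matrix_def\<close>)
    then show ?thesis by simp
  qed simp
  have id: "id ` {0::real..} \<subseteq> {0..}" "mono_on {0::real..} id" by (auto simp: mono_on_def)
  have diag: "U $ i $ j \<le> U $ j $ j" "U $ j $ i \<le> U $ j $ j" for i j
    using diag_le[OF cmp(1)[OF id]] diag_le[OF cmp(2)[OF id], of i j] assms(1)
    by (auto simp: nonneg_matrix_def transpose_def)
  have step: "complete_max_principle (map_matrix (two_step a b) U)"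
    "complete_max_principle (map_matrix (two_step a b) (transpose U))" if "a \<le> b" for a b
    by (rule cmp[OF two_step_range mono_on_two_step[OF that]])+
  have diag': "transpose U $ i $ j \<le> transpose U $ j $ j" "transpose U $ j $ i \<le> transpose U $ j $ j"
    for i j using diag by (auto simp: transpose_def)
  \<comment> \<open>The context assumptions hold for \<open>U\<close> and for its transpose, so each
    entry inequality is available in a row and a column form.\<close>
  note rows = diag(2,1) step(1)
  note cols = diag'(2,1) step(2)
  have "preferred_element U i j k \<or> preferred_element U j i k \<or> preferred_element U k i j"
    if "i \<noteq> j" "i \<noteq> k" "j \<noteq> k" for i j k
  proof (rule preferred_element_exists)
    show "min (U $ i $ k) (U $ k $ j) \<le> U $ i $ j" if "k \<noteq> j" for i j k
      by (rule two_step_min_le[OF rows that])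
    show "min (U $ i $ j) (U $ i $ k) \<le> max (U $ j $ k) (U $ k $ j)" if "j \<noteq> k" for i j k
      by (rule two_step_min_le_max[OF rows that])
    show "min (U $ j $ i) (U $ k $ i) \<le> max (U $ j $ k) (U $ k $ j)" if "j \<noteq> k" for i j k
      using two_step_min_le_max[OF cols that, of i] by (simp add: transpose_def max.commute)
    show "min (U $ k $ i) (U $ i $ j) \<le> U $ j $ i"
      if "i \<noteq> j" "U $ k $ i < U $ k $ j" "U $ i $ j < U $ k $ j" for i j k
      by (rule two_step_shortcut[OF rows that])
    show "min (U $ k $ i) (U $ i $ j) \<le> U $ i $ k"
      if "i \<noteq> k" "U $ k $ i < U $ k $ j" "U $ i $ j < U $ k $ j" for i j k
      \<comment> \<open>Swapping \<open>j\<close> and \<open>k\<close> offsets the transposition in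
        the hypotheses; the conclusion now bounds the reverse of the other leg.\<close>
      using two_step_shortcut[OF cols, of i k j] that by (simp add: transpose_def min.commute)
  qed (use that in auto)
  then show ?thesis
    using assms(1) diag by (auto simp: GUM_def not_le)
qed

end
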